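(* Let $v$ be a vertex, let $p$ be an $\mathrm{evenlevel}(v)$ path or an $\mathrm{oddlevel}(v)$ path, starting at unmatched vertex $f$, and let $u$ be a vertex on $p$ with $t(u)\ge t(v)$. Then $u$ is BFS-honest with respect to $p$. Furthermore, if $t(u)>t(v)$ then $|p[f\text{ to }u]|=\mathrm{minlevel}(u)$.
   Context: $G=(V,E)$ is a finite undirected graph with a matching $M$, and at least one vertex of $G$ is not covered by $M$ (is unmatched). An alternating path is a simple path whose edges alternate between edges not in $M$ (unmatched) and edges in $M$ (matched); an alternating path from an unmatched vertex starts with an unmatched edge. $\mathrm{evenlevel}(v)$ (resp. $\mathrm{oddlevel}(v)$) is the minimum length of an even (resp. odd) length alternating path from some unmatched vertex to $v$ ($\infty$ if none); any alternating path from an unmatched vertex to $v$ of this minimum even (resp. odd) length is called an $\mathrm{evenlevel}(v)$ (resp. $\mathrm{oddlevel}(v)$) path. $\mathrm{minlevel}(v)$ is the smaller of $\mathrm{evenlevel}(v),\mathrm{oddlevel}(v)$. The tenacity of a vertex is $t(v)=\mathrm{evenlevel}(v)+\mathrm{oddlevel}(v)$. For a path $p$ starting at $f$ and a vertex $u$ on $p$, $p[f\text{ to }u]$ is the subpath of $p$ from $f$ to $u$ and $|\cdot|$ denotes length; $u$ is even (odd) w.r.t. $p$ if $|p[f\text{ to }u]|$ is even (odd). $u$ is BFS-honest w.r.t. $p$ if $|p[f\text{ to }u]|=\mathrm{evenlevel}(u)$ when $u$ is even w.r.t. $p$, and $|p[f\text{ to }u]|=\mathrm{oddlevel}(u)$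 when $u$ is odd w.r.t. $p$. *)

theory Defs
  imports "HOL-Library.Extended_Nat"
begin

definition finite_graph :: "'a set \<Rightarrow> 'a set set \<Rightarrow> bool" where
  "finite_graph V E \<longleftrightarrow> finite V \<and> (\<forall>e\<in>E. e \<subseteq> V \<and> card e = 2)"

definition matching :: "'a set set \<Rightarrow> 'a set set \<Rightarrow> bool" where
  "matching E M \<longleftrightarrow> M \<subseteq> E \<and> (\<forall>e\<in>M. \<forall>e'\<in>M. e \<noteq> e' \<longrightarrow> e \<inter> e' = {})"

definition unmatched :: "'a set \<Rightarrow> 'a set set \<Rightarrow> 'a \<Rightarrow> bool" where
  "unmatched V M v \<longleftrightarrow> v \<in> V \<and> (\<forall>e\<in>M. v \<notin> e)"

text \<open>A path is the list of the vertices it visits, so a path of length \<open>k\<close> is a list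
  with \<open>k + 1\<close> elements.\<close>

definition path_length :: "'a list \<Rightarrow> nat" where
  "path_length p = length p - 1"

definition simple_path :: "'a set \<Rightarrow> 'a set set \<Rightarrow> 'a list \<Rightarrow> bool" where
  "simple_path V E p \<longleftrightarrow> p \<noteq> [] \<and> distinct p \<and> set p \<subseteq> V \<and>
     (\<forall>i. Suc i < length p \<longrightarrow> {p ! i, p ! Suc i} \<in> E)"

definition alternating_path :: "'a set \<Rightarrow> 'a set set \<Rightarrow> 'a set set \<Rightarrow> 'a list \<Rightarrow> bool" where
  "alternating_path V E M p \<longleftrightarrow> simple_path V E p \<and>
     (\<forall>i. Suc (Suc i) < length p \<longrightarrow>
        ({p ! i, p ! Suc i} \<in> M \<longleftrightarrow> {p ! Suc i, p ! Suc (Suc i)} \<notin> M))"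

text \<open>The first edge of such a path is unmatched because no edge of \<open>M\<close> covers \<open>f\<close>. The
  one-vertex path (length 0) from an unmatched vertex to itself is included.\<close>

definition alt_path_from_to ::
  "'a set \<Rightarrow> 'a set set \<Rightarrow> 'a set set \<Rightarrow> 'a \<Rightarrow> 'a \<Rightarrow> 'a list \<Rightarrow> bool" where
  "alt_path_from_to V E M f v p \<longleftrightarrow>
     alternating_path V E M p \<and> unmatched V M f \<and> hd p = f \<and> last p = v"

text \<open>The infimum of the empty set in \<^typ>\<open>enat\<close> is \<open>\<infinity>\<close>.\<close>

definition evenlevel :: "'a set \<Rightarrow> 'a set set \<Rightarrow> 'a set set \<Rightarrow> 'a \<Rightarrow> enat" where
  "evenlevel V E M v =
     Inf {enat (path_length p) | p f. alt_path_from_to V E M f v p \<and> even (path_length p)}"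

definition oddlevel :: "'a set \<Rightarrow> 'a set set \<Rightarrow> 'a set set \<Rightarrow> 'a \<Rightarrow> enat" where
  "oddlevel V E M v =
     Inf {enat (path_length p) | p f. alt_path_from_to V E M f v p \<and> odd (path_length p)}"

definition evenlevel_path ::
  "'a set \<Rightarrow> 'a set set \<Rightarrow> 'a set set \<Rightarrow> 'a \<Rightarrow> 'a \<Rightarrow> 'a list \<Rightarrow> bool" where
  "evenlevel_path V E M f v p \<longleftrightarrow> alt_path_from_to V E M f v p \<and>
     even (path_length p) \<and> enat (path_length p) = evenlevel V E M v"

definition oddlevel_path ::
  "'a set \<Rightarrow> 'a set set \<Rightarrow> 'a set set \<Rightarrow> 'a \<Rightarrow> 'a \<Rightarrow> 'a list \<Rightarrow> bool" where
  "oddlevel_path V E M f v p \<longleftrightarrow> alt_path_from_to V E M f v p \<and>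
     odd (path_length p) \<and> enat (path_length p) = oddlevel V E M v"

definition minlevel :: "'a set \<Rightarrow> 'a set set \<Rightarrow> 'a set set \<Rightarrow> 'a \<Rightarrow> enat" where
  "minlevel V E M v = min (evenlevel V E M v) (oddlevel V E M v)"

definition tenacity :: "'a set \<Rightarrow> 'a set set \<Rightarrow> 'a set set \<Rightarrow> 'a \<Rightarrow> enat" where
  "tenacity V E M v = evenlevel V E M v + oddlevel V E M v"

text \<open>The subpath from the first vertex of \<open>p\<close> to \<open>u\<close>, meaningful for \<open>u \<in> set p\<close>.\<close>

definition subpath_to :: "'a list \<Rightarrow> 'a \<Rightarrow> 'a list" where
  "subpath_to p u = takeWhile (\<lambda>x. x \<noteq> u) p @ [u]"

definition bfs_honest :: "'a set \<Rightarrow> 'a set set \<Rightarrow> 'a set set \<Rightarrow> 'a list \<Rightarrow> 'a \<Rightarrow> bool" where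
  "bfs_honest V E M p u \<longleftrightarrow>
     (even (path_length (subpath_to p u)) \<longrightarrow>
        enat (path_length (subpath_to p u)) = evenlevel V E M u) \<and>
     (odd (path_length (subpath_to p u)) \<longrightarrow>
        enat (path_length (subpath_to p u)) = oddlevel V E M u)"

end

theory Submission
  imports Defs
begin

text \<open>Let \<open>p\<close> be a level path to \<open>v\<close> of length \<open>n\<close> with \<open>u\<close> at position \<open>k\<close>. Follow any
  alternating path from an unmatched vertex to a vertex of \<open>p[u to v]\<close> until it first meets
  \<open>p[u to v]\<close>, at its own position \<open>j\<close> and at position \<open>m\<close> of \<open>p\<close>. If \<open>j + m\<close> is even, one can
  continue along \<open>p\<close> to \<open>v\<close>, so \<open>j \<ge> m \<ge> k\<close> by minimality of \<open>p\<close>. If \<open>j + m\<close> is odd, one can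
  continue backwards along \<open>p\<close> to \<open>u\<close>, which gives a path to \<open>u\<close> of length \<open>j + m - k\<close>, whose
  parity is opposite to that of \<open>k\<close>.

  Apply this to a path to \<open>v\<close> of length \<open>t(v) - n\<close>. If \<open>t(v) - n < k\<close>, the even case is excluded, so
  the level of \<open>u\<close> of parity opposite to \<open>k\<close> is at most \<open>t(v) - k\<close>.

  Suppose that the level \<open>l\<close> of \<open>u\<close> of the same parity as \<open>k\<close> is below \<open>k\<close>. The first observation for
  a path of length \<open>l\<close> to \<open>u\<close> gives \<open>t(v) \<le> t(u) \<le> l + (l + n - k) < n + k\<close>, and then the second one
  gives \<open>t(u) \<le> l + t(v) - k < t(v)\<close>, a contradiction. So \<open>l = k\<close>. If the level of opposite parity is
  below \<open>k\<close> and \<open>t(v) < t(u)\<close>, then \<open>t(v) < 2 k \<le> n + k\<close>, and the second observation gives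
  \<open>t(u) \<le> k + t(v) - k = t(v)\<close>, again a contradiction.\<close>

text \<open>Only the parity of \<open>n\<close> matters: \<open>n\<close> and \<open>Suc n\<close>
  select the two levels, so even and odd cases share one argument.\<close>

definition parity_level :: "'a set \<Rightarrow> 'a set set \<Rightarrow> 'a set set \<Rightarrow> nat \<Rightarrow> 'a \<Rightarrow> enat" where
  "parity_level V E M n w = (if even n then evenlevel V E M w else oddlevel V E M w)"

lemma tenacity_eq_parity_levels:
  "tenacity V E M w = parity_level V E M n w + parity_level V E M (Suc n) w"
  by (simp add: tenacity_def parity_level_def add.commute)

lemma minlevel_eq_parity_levels:
  "minlevel V E M w = min (parity_level V E M n w) (parity_level V E M (Suc n) w)"
  by (simp add: minlevel_def parity_level_def min.commute)

lemma parity_level_le: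
  assumes "alt_path_from_to V E M f w p" "even (path_length p) = even n"
  shows "parity_level V E M n w \<le> enat (path_length p)"
  using assms unfolding parity_level_def evenlevel_def oddlevel_def
  by (auto intro!: Inf_lower)

lemma parity_level_path:
  assumes "parity_level V E M n w = enat k"
  obtains f p where "alt_path_from_to V E M f w p" "path_length p = k" "even k = even n"
proof -
  define S where "S = {enat (path_length p) | p f.
    alt_path_from_to V E M f w p \<and> even (path_length p) = even n}"
  have level: "parity_level V E M n w = Inf S"
    by (simp add: parity_level_def evenlevel_def oddlevel_def S_def)
  \<comment> \<open>The infimum of the empty set would be \<open>\<infinity>\<close>.\<close>
  then have "S \<noteq> {}"
    using assms by (auto simp: Inf_enat_def)
  then have "Inf S \<in> S"
    by (auto simp: Inf_enat_def intro: LeastI)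
  then show ?thesis
    using assms level that unfolding S_def by force
qed

text \<open>Since \<open>f\<close> is unmatched, alternation fixes the status of every edge by its
  index, so joining paths reduces to a parity check.\<close>

lemma alt_path_from_to_iff:
  "alt_path_from_to V E M f v p \<longleftrightarrow>
     unmatched V M f \<and> p \<noteq> [] \<and> hd p = f \<and> last p = v \<and> distinct p \<and> set p \<subseteq> V \<and>
     (\<forall>i. Suc i < length p \<longrightarrow>
        {p ! i, p ! Suc i} \<in> E \<and> ({p ! i, p ! Suc i} \<in> M \<longleftrightarrow> odd i))"
    (is "?L \<longleftrightarrow> ?R")
proof
  assume L: ?L
  have "{p ! i, p ! Suc i} \<in> M \<longleftrightarrow> odd i" if "Suc i < length p" for i
    using that
  proof (induction i)
    case 0
    have "p ! 0 = f" "unmatched V M f"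
      using L by (auto simp: alt_path_from_to_def alternating_path_def simple_path_def hd_conv_nth)
    then show ?case
      by (auto simp: unmatched_def)
  next
    case (Suc i)
    then show ?case
      using L by (auto simp: alt_path_from_to_def alternating_path_def)
  qed
  then show ?R
    using L by (auto simp: alt_path_from_to_def alternating_path_def simple_path_def)
next
  assume ?R
  then show ?L
    by (auto simp: alt_path_from_to_def alternating_path_def simple_path_def)
qed

text \<open>Index \<open>i\<close> of \<open>ys\<close> becomes index \<open>j + i\<close> of the
  joined path; \<open>q ! j\<close> is dropped from \<open>q\<close> because it heads
  \<open>ys\<close>.\<close>

lemma alt_path_splice:
  assumes Q: "alt_path_from_to V E M g w q" and j: "j < length q"
    and ys: "ys \<noteq> []" "hd ys = q ! j" "distinct ys" "set ys \<subseteq> V"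
    and disj: "set (take j q) \<inter> set ys = {}"
    and edges: "\<And>i. Suc i < length ys \<Longrightarrow>
      {ys ! i, ys ! Suc i} \<in> E \<and> ({ys ! i, ys ! Suc i} \<in> M \<longleftrightarrow> odd (j + i))"
  shows "alt_path_from_to V E M g (last ys) (take j q @ ys)"
proof -
  let ?x = "take j q @ ys"
  have ys0: "ys ! 0 = q ! j"
    using ys by (simp add: hd_conv_nth)
  have x1: "?x ! i = q ! i" if "i \<le> j" for i
    using that j ys0 by (auto simp: nth_append)
  have x2: "?x ! (j + i) = ys ! i" for i
    using j by (simp add: nth_append)
  have len: "length ?x = j + length ys"
    using j by simp
  have "{?x ! i, ?x ! Suc i} \<in> E \<and> ({?x ! i, ?x ! Suc i} \<in> M \<longleftrightarrow> odd i)"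
    if i: "Suc i < length ?x" for i
  proof (cases "i < j")
    case True
    then show ?thesis
      using Q j x1[of i] x1[of "Suc i"] by (simp add: alt_path_from_to_iff)
  next
    case False
    then obtain d where d: "i = j + d"
      using le_Suc_ex not_less by blast
    show ?thesis
      using edges[of d] i len x2[of d] x2[of "Suc d"] by (simp add: d)
  qed
  moreover have "hd ?x = g"
    using Q ys x1[of 0] by (auto simp: hd_conv_nth alt_path_from_to_iff simp del: hd_append2)
  ultimately show ?thesis
    using Q ys disj by (auto simp: alt_path_from_to_iff dest: in_set_takeD)
qed

text \<open>Taking the first hit makes the part of \<open>q\<close> before it disjoint from
  \<open>drop k p\<close>, so either direction along \<open>p\<close> stays simple. The parity of
  \<open>j + m\<close> decides which direction keeps the alternation.\<close>

lemma alt_path_first_hit: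
  assumes P: "alt_path_from_to V E M f v p" and k: "k < length p"
    and Q: "alt_path_from_to V E M g w q" and w: "w \<in> set (drop k p)"
  obtains j m where "j \<le> path_length q" "k \<le> m" "m \<le> path_length p"
    and "even (j + m) \<longrightarrow>
      (\<exists>x. alt_path_from_to V E M g v x \<and> path_length x = j + (path_length p - m))"
    and "odd (j + m) \<longrightarrow>
      (\<exists>x. alt_path_from_to V E M g (p ! k) x \<and> path_length x = j + (m - k))"
proof -
  let ?hit = "\<lambda>j. j < length q \<and> q ! j \<in> set (drop k p)"
  define j where "j = (LEAST j. ?hit j)"
  have "?hit (length q - 1)"
    using Q w by (auto simp: alt_path_from_to_iff last_conv_nth)
  then have j: "?hit j"
    unfolding j_def by (rule LeastI)
  have before: "\<not> ?hit i" if "i < j" for i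
    using that not_less_Least unfolding j_def by blast
  have disj: "set (take j q) \<inter> set (drop k p) = {}"
    using before j by (auto simp: in_set_conv_nth[of _ "take j q"])
  obtain i where i: "i < length p - k" "q ! j = p ! (k + i)"
    using j by (auto simp: in_set_conv_nth[of _ "drop k p"])
  define m where "m = k + i"
  have m: "k \<le> m" "m < length p" "p ! m = q ! j"
    using i by (auto simp: m_def)
  have pedge: "{p ! i, p ! Suc i} \<in> E \<and> ({p ! i, p ! Suc i} \<in> M \<longleftrightarrow> odd i)"
    if "Suc i < length p" for i
    using P that by (simp add: alt_path_from_to_iff)
  have p: "distinct p" "set p \<subseteq> V" "last p = v"
    using P by (auto simp: alt_path_from_to_iff)
  have forward: "\<exists>x. alt_path_from_to V E M g v x \<and> path_length x = j + (path_length p - m)"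
    if even: "even (j + m)"
  proof -
    let ?ys = "drop m p"
    have "set ?ys \<subseteq> set (drop k p)"
      using m by (simp add: set_drop_subset_set_drop)
    then have "alt_path_from_to V E M g (last ?ys) (take j q @ ?ys)"
      using j m p disj pedge even
      by (intro alt_path_splice[OF Q])
        (auto simp: hd_drop_conv_nth dest: in_set_dropD)
    moreover have "path_length (take j q @ ?ys) = j + (path_length p - m)"
      using j m by (simp add: path_length_def)
    ultimately show ?thesis
      using m p by (metis last_drop)
  qed
  have backward: "\<exists>x. alt_path_from_to V E M g (p ! k) x \<and> path_length x = j + (m - k)"
    if odd: "odd (j + m)"
  proof -
    let ?ys = "rev (take (Suc m - k) (drop k p))"
    have len: "length ?ys = Suc m - k"
      using m by simp
    have nth: "?ys ! i = p ! (m - i)" if "i \<le> m - k" for i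
      using that m by (simp add: rev_nth)
    have ne: "?ys \<noteq> []"
      using m by simp
    have sub: "set ?ys \<subseteq> set (drop k p)"
      by (auto dest: in_set_takeD)
    have "{?ys ! i, ?ys ! Suc i} \<in> E \<and> ({?ys ! i, ?ys ! Suc i} \<in> M \<longleftrightarrow> odd (j + i))"
      if i: "Suc i < length ?ys" for i
    proof -
      have "Suc (m - Suc i) = m - i" "Suc i \<le> m - k"
        using i len by auto
      \<comment> \<open>The two numbers add up to \<open>j + m - 1\<close>, which is even.\<close>
      moreover have "odd (m - Suc i) \<longleftrightarrow> odd (j + i)"
        using odd i len by auto
      ultimately show ?thesis
        using pedge[of "m - Suc i"] nth[of i] nth[of "Suc i"] m
        by (simp add: insert_commute)
    qed
    moreover have "hd ?ys = q ! j"
      using nth[of 0] ne m by (simp add: hd_conv_nth)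
    moreover have last: "last ?ys = p ! k"
      using nth[of "m - k"] ne len m by (simp add: last_conv_nth Suc_diff_le)
    moreover have "set ?ys \<subseteq> V" "distinct ?ys" "set (take j q) \<inter> set ?ys = {}"
      using p sub disj set_drop_subset[of k p] by auto
    ultimately have "alt_path_from_to V E M g (last ?ys) (take j q @ ?ys)"
      using j ne by (intro alt_path_splice[OF Q]) blast+
    moreover have "path_length (take j q @ ?ys) = j + (m - k)"
      using j m by (simp add: path_length_def)
    ultimately show ?thesis
      using last by metis
  qed
  show ?thesis
  proof (rule that)
    show "j \<le> path_length q" "k \<le> m" "m \<le> path_length p"
      using j m by (auto simp: path_length_def)
  qed (use forward backward in blast)+
qed

context
  fixes V :: "'a set" and E M :: "'a set set" and f v :: 'a and p :: "'a list" and k :: nat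
  assumes P: "alt_path_from_to V E M f v p"
    and shortest: "enat (path_length p) = parity_level V E M (path_length p) v"
    and k: "k < length p"
begin

text \<open>An even hit would give a path to \<open>v\<close> of the parity of \<open>p\<close> that
  is shorter than \<open>p\<close>, as \<open>j < k \<le> m\<close>. Hence the path turns back to
  \<open>p ! k\<close>.\<close>

lemma opposite_level_via_short_path:
  assumes Q: "alt_path_from_to V E M g w q" and w: "w \<in> set (drop k p)"
    and short: "path_length q < k"
  shows "parity_level V E M (Suc k) (p ! k) \<le> enat (path_length q + path_length p - k)"
proof -
  obtain j m where jm: "j \<le> path_length q" "k \<le> m" "m \<le> path_length p"
    and forward: "even (j + m) \<longrightarrow>
      (\<exists>x. alt_path_from_to V E M g v x \<and> path_length x = j + (path_length p - m))"
    and backward: "odd (j + m) \<longrightarrow>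
      (\<exists>x. alt_path_from_to V E M g (p ! k) x \<and> path_length x = j + (m - k))"
    using alt_path_first_hit[OF P k Q w] by blast
  have "odd (j + m)"
  proof
    assume even: "even (j + m)"
    then obtain x where x: "alt_path_from_to V E M g v x"
      "path_length x = j + (path_length p - m)"
      using forward by auto
    have "even (path_length x) = even (path_length p)"
      using x(2) jm even by auto
    then have "path_length p \<le> path_length x"
      using parity_level_le[OF x(1)] shortest by (metis enat_ord_simps(1))
    then show False
      using x(2) jm short by linarith
  qed
  then obtain x where x: "alt_path_from_to V E M g (p ! k) x" "path_length x = j + (m - k)"
    using backward by auto
  have "even (path_length x) = even (Suc k)"
    using x(2) jm \<open>odd (j + m)\<close> by auto
  then have "parity_level V E M (Suc k) (p ! k) \<le> enat (path_length x)"
    by (rule parity_level_le[OF x(1)])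
  also have "\<dots> \<le> enat (path_length q + path_length p - k)"
    using x(2) jm by simp
  finally show ?thesis .
qed

text \<open>The other level of \<open>v\<close> is finite, say \<open>c\<close>, with
  \<open>t = path_length p + c\<close>; thus \<open>short\<close> says that
  \<open>c < k\<close>.\<close>

lemma opposite_level_le:
  assumes t: "tenacity V E M v = enat t" and short: "t < path_length p + k"
  shows "parity_level V E M (Suc k) (p ! k) \<le> enat (t - k)"
proof -
  have "enat t = enat (path_length p) + parity_level V E M (Suc (path_length p)) v"
    using t shortest tenacity_eq_parity_levels[of V E M v "path_length p"] by simp
  then obtain c where c: "parity_level V E M (Suc (path_length p)) v = enat c"
    "t = path_length p + c"
    by (cases "parity_level V E M (Suc (path_length p)) v") auto
  obtain g r where r: "alt_path_from_to V E M g v r" "path_length r = c"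
    using parity_level_path[OF c(1)] by metis
  have "v \<in> set (drop k p)"
    using P k by (metis alt_path_from_to_iff drop_eq_Nil last_drop last_in_set not_less)
  then show ?thesis
    using opposite_level_via_short_path[OF r(1)] r(2) c(2) short by (simp add: add.commute)
qed

lemma level_on_path:
  assumes ten: "tenacity V E M v \<le> tenacity V E M (p ! k)"
  shows "parity_level V E M k (p ! k) = enat k"
proof (rule ccontr)
  assume neq: "parity_level V E M k (p ! k) \<noteq> enat k"
  have "last (take (Suc k) p) = p ! k"
    using k by (simp add: take_Suc_conv_app_nth)
  then have "alt_path_from_to V E M f (p ! k) (take (Suc k) p)"
    using P by (auto simp: alt_path_from_to_iff dest: in_set_takeD)
  moreover have "path_length (take (Suc k) p) = k"
    using k by (simp add: path_length_def)
  ultimately have "parity_level V E M k (p ! k) < enat k"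
    using parity_level_le[of V E M f "p ! k" "take (Suc k) p" k] neq by simp
  then obtain l where l: "parity_level V E M k (p ! k) = enat l" "l < k"
    by (metis enat_ord_simps(2) less_enatE)
  obtain g q where q: "alt_path_from_to V E M g (p ! k) q" "path_length q = l"
    using parity_level_path[OF l(1)] by metis
  have "p ! k \<in> set (drop k p)"
    using k by (metis Cons_nth_drop_Suc list.set_intros(1))
  then have "parity_level V E M (Suc k) (p ! k) \<le> enat (l + path_length p - k)"
    using opposite_level_via_short_path[OF q(1)] q(2) l(2) by simp
  then have "tenacity V E M (p ! k) \<le> enat (l + (l + path_length p - k))"
    unfolding tenacity_eq_parity_levels[of V E M "p ! k" k] l(1) plus_enat_simps(1)[symmetric]
    by (rule add_left_mono)
  \<comment> \<open>The finite bound for \<open>p ! k\<close> also makes the tenacity of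
    \<open>v\<close> finite, as \<open>opposite_level_le\<close> requires.\<close>
  with ten obtain t where t: "tenacity V E M v = enat t" "t \<le> l + (l + path_length p - k)"
    by (metis enat_ile enat_ord_simps(1) order_trans)
  have kn: "k \<le> path_length p"
    using k by (simp add: path_length_def)
  \<comment> \<open>With \<open>kn\<close> this gives \<open>k \<le> t\<close>, so that
    \<open>t - k\<close> is not truncated.\<close>
  have tn: "path_length p \<le> t"
    using t(1) shortest tenacity_eq_parity_levels[of V E M v "path_length p"]
    by (metis enat_ord_simps(1) le_iff_add)
  have "parity_level V E M (Suc k) (p ! k) \<le> enat (t - k)"
    using opposite_level_le[OF t(1)] t(2) l(2) kn by linarith
  then have "tenacity V E M (p ! k) \<le> enat (l + (t - k))"
    unfolding tenacity_eq_parity_levels[of V E M "p ! k" k] l(1) plus_enat_simps(1)[symmetric]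
    by (rule add_left_mono)
  then have "enat t \<le> enat (l + (t - k))"
    using ten unfolding t(1) by (rule order_trans[rotated])
  then show False
    using l(2) kn tn by simp
qed

lemma minlevel_on_path:
  assumes ten: "tenacity V E M v < tenacity V E M (p ! k)"
  shows "minlevel V E M (p ! k) = enat k"
proof -
  have level: "parity_level V E M k (p ! k) = enat k"
    using level_on_path ten by simp
  have kn: "k \<le> path_length p"
    using k by (simp add: path_length_def)
  obtain t where t: "tenacity V E M v = enat t"
    using ten by (cases "tenacity V E M v") auto
  have tn: "path_length p \<le> t"
    using t shortest tenacity_eq_parity_levels[of V E M v "path_length p"]
    by (metis enat_ord_simps(1) le_iff_add)
  \<comment> \<open>The opposite level may be infinite here, so the bound stays in
    \<open>enat\<close>.\<close>
  have lower: "enat t < enat k + parity_level V E M (Suc k) (p ! k)"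
    using ten t level tenacity_eq_parity_levels[of V E M "p ! k" k] by simp
  have "enat k \<le> parity_level V E M (Suc k) (p ! k)"
  proof (rule ccontr)
    assume "\<not> ?thesis"
    then obtain l where l: "parity_level V E M (Suc k) (p ! k) = enat l" "l < k"
      by (metis enat_ord_simps(2) less_enatE not_le)
    then have "t < path_length p + k"
      using lower kn by simp
    then have "l \<le> t - k"
      using opposite_level_le[OF t] l(1) by simp
    then show False
      using lower l(1) tn kn by simp
  qed
  then show ?thesis
    by (simp add: minlevel_eq_parity_levels[of V E M "p ! k" k] level)
qed

end

text \<open>Distinctness stops \<open>takeWhile\<close> at index \<open>k\<close> and not
  earlier.\<close>

lemma path_length_subpath_to_nth:
  assumes "distinct p" "k < length p"
  shows "path_length (subpath_to p (p ! k)) = k"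
proof -
  have "takeWhile (\<lambda>x. x \<noteq> p ! k) p = take k p"
    using assms by (intro takeWhile_eq_take_P_nth) (auto simp: nth_eq_iff_index_eq)
  then show ?thesis
    using assms by (simp add: subpath_to_def path_length_def)
qed

theorem theorem1:
  fixes V :: "'a set" and E M :: "'a set set" and f u v :: 'a and p :: "'a list"
  assumes "finite_graph V E"
    and "matching E M"
    and "\<exists>w. unmatched V M w"
    and "v \<in> V"
    and "unmatched V M f"
    and "evenlevel_path V E M f v p \<or> oddlevel_path V E M f v p"
    and "u \<in> set p"
    and "tenacity V E M u \<ge> tenacity V E M v"
  shows "bfs_honest V E M p u \<and>
         (tenacity V E M u > tenacity V E M v \<longrightarrow>
            enat (path_length (subpath_to p u)) = minlevel V E M u)"
proof -
  have P: "alt_path_from_to V E M f v p"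
    and shortest: "enat (path_length p) = parity_level V E M (path_length p) v"
    using assms(6) by (auto simp: evenlevel_path_def oddlevel_path_def parity_level_def)
  obtain k where k: "k < length p" "u = p ! k"
    using assms(7) by (auto simp: in_set_conv_nth)
  have len: "path_length (subpath_to p u) = k"
    using path_length_subpath_to_nth[of p k] P k by (simp add: alt_path_from_to_iff)
  have "parity_level V E M k u = enat k"
    using level_on_path[OF P shortest k(1)] assms(8) k(2) by simp
  then have "bfs_honest V E M p u"
    by (auto simp: bfs_honest_def len parity_level_def)
  then show ?thesis
    using minlevel_on_path[OF P shortest k(1)] k(2) len by simp
qed

end
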